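(* The class of $^\star$-involutive idempotent residuated chains has the strong amalgamation property.
   Context: A residuated lattice is an algebra $(A,\wedge,\vee,\cdot,\backslash,/,1)$ such that $(A,\wedge,\vee)$ is a lattice, $(A,\cdot,1)$ is a monoid, and $y\le x\backslash z \iff x\cdot y\le z\iff x\le z/y$ for all $x,y,z$. An idempotent residuated chain is a residuated lattice whose lattice order is total and which satisfies $x\cdot x=x$. Define $x^r:=x\backslash 1$, $x^\ell:=1/x$, $x^\star:=x^\ell\wedge x^r$. An idempotent residuated chain is $^\star$-involutive if it satisfies $x^{\star\star}=x$. A class $\mathcal K$ of similar algebras has the strong amalgamation property if for all $\mathbf A,\mathbf B,\mathbf C\in\mathcal K$ and embeddings $f_B\colon\mathbf A\to\mathbf B$, $f_C\colon\mathbf A\to\mathbf C$ there are $\mathbf D\in\mathcal K$ and embeddings $g_B\colon\mathbf B\to\mathbf D$, $g_C\colon\mathbf C\to\mathbf D$ with $g_B\circ f_B=g_C\circ f_C$ and $(g_B\circ f_B)[A]=g_B[B]\cap g_C[C]$. *)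

theory Defs
  imports "HOL-Algebra.Group" "HOL-Library.FuncSet"
begin

text \<open>
  Algebras in the signature \<open>(\<and>, \<or>, \<cdot>, \, /, 1)\<close> with an explicit carrier; the fields
  \<open>carrier\<close>, \<open>mult\<close>, \<open>one\<close> are inherited from the monoid record of HOL-Algebra.
  \<open>ldiv A x z\<close> is \<open>x \ z\<close> and \<open>rdiv A z y\<close> is \<open>z / y\<close>.
\<close>

record 'a rl_algebra = "'a monoid" +
  rmeet :: "'a \<Rightarrow> 'a \<Rightarrow> 'a" (infixl \<open>\<curlywedge>\<index>\<close> 70)
  rjoin :: "'a \<Rightarrow> 'a \<Rightarrow> 'a" (infixl \<open>\<curlyvee>\<index>\<close> 65)
  ldiv :: "'a \<Rightarrow> 'a \<Rightarrow> 'a"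
  rdiv :: "'a \<Rightarrow> 'a \<Rightarrow> 'a"

definition rle :: "('a, 'm) rl_algebra_scheme \<Rightarrow> 'a \<Rightarrow> 'a \<Rightarrow> bool" (infix \<open>\<preceq>\<index>\<close> 50)
  where "x \<preceq>\<^bsub>A\<^esub> y \<longleftrightarrow> x \<curlywedge>\<^bsub>A\<^esub> y = x"

locale residuated_lattice = monoid A for A (structure) +
  assumes meet_closed: "\<lbrakk>x \<in> carrier A; y \<in> carrier A\<rbrakk> \<Longrightarrow> x \<curlywedge> y \<in> carrier A"
    and join_closed: "\<lbrakk>x \<in> carrier A; y \<in> carrier A\<rbrakk> \<Longrightarrow> x \<curlyvee> y \<in> carrier A"
    and ldiv_closed: "\<lbrakk>x \<in> carrier A; y \<in> carrier A\<rbrakk> \<Longrightarrow> ldiv A x y \<in> carrier A"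
    and rdiv_closed: "\<lbrakk>x \<in> carrier A; y \<in> carrier A\<rbrakk> \<Longrightarrow> rdiv A x y \<in> carrier A"
    and meet_assoc: "\<lbrakk>x \<in> carrier A; y \<in> carrier A; z \<in> carrier A\<rbrakk>
          \<Longrightarrow> (x \<curlywedge> y) \<curlywedge> z = x \<curlywedge> (y \<curlywedge> z)"
    and join_assoc: "\<lbrakk>x \<in> carrier A; y \<in> carrier A; z \<in> carrier A\<rbrakk>
          \<Longrightarrow> (x \<curlyvee> y) \<curlyvee> z = x \<curlyvee> (y \<curlyvee> z)"
    and meet_comm: "\<lbrakk>x \<in> carrier A; y \<in> carrier A\<rbrakk> \<Longrightarrow> x \<curlywedge> y = y \<curlywedge> x"
    and join_comm: "\<lbrakk>x \<in> carrier A; y \<in> carrier A\<rbrakk> \<Longrightarrow> x \<curlyvee> y = y \<curlyvee> x"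
    and meet_join_absorb: "\<lbrakk>x \<in> carrier A; y \<in> carrier A\<rbrakk> \<Longrightarrow> x \<curlywedge> (x \<curlyvee> y) = x"
    and join_meet_absorb: "\<lbrakk>x \<in> carrier A; y \<in> carrier A\<rbrakk> \<Longrightarrow> x \<curlyvee> (x \<curlywedge> y) = x"
    and ldiv_residuation: "\<lbrakk>x \<in> carrier A; y \<in> carrier A; z \<in> carrier A\<rbrakk>
          \<Longrightarrow> y \<preceq> ldiv A x z \<longleftrightarrow> x \<otimes> y \<preceq> z"
    and rdiv_residuation: "\<lbrakk>x \<in> carrier A; y \<in> carrier A; z \<in> carrier A\<rbrakk>
          \<Longrightarrow> x \<otimes> y \<preceq> z \<longleftrightarrow> x \<preceq> rdiv A z y"

locale idempotent_residuated_chain = residuated_lattice A for A (structure) +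
  assumes total: "\<lbrakk>x \<in> carrier A; y \<in> carrier A\<rbrakk> \<Longrightarrow> x \<preceq> y \<or> y \<preceq> x"
    and idempotent: "x \<in> carrier A \<Longrightarrow> x \<otimes> x = x"

definition rneg :: "('a, 'm) rl_algebra_scheme \<Rightarrow> 'a \<Rightarrow> 'a"
  where "rneg A x = ldiv A x \<one>\<^bsub>A\<^esub>"

definition lneg :: "('a, 'm) rl_algebra_scheme \<Rightarrow> 'a \<Rightarrow> 'a"
  where "lneg A x = rdiv A \<one>\<^bsub>A\<^esub> x"

definition star :: "('a, 'm) rl_algebra_scheme \<Rightarrow> 'a \<Rightarrow> 'a"
  where "star A x = lneg A x \<curlywedge>\<^bsub>A\<^esub> rneg A x"

locale star_involutive_idempotent_residuated_chain =
  idempotent_residuated_chain A for A (structure) +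
  assumes star_involutive: "x \<in> carrier A \<Longrightarrow> star A (star A x) = x"

definition rl_embedding ::
    "('a, 'm) rl_algebra_scheme \<Rightarrow> ('b, 'n) rl_algebra_scheme \<Rightarrow> ('a \<Rightarrow> 'b) \<Rightarrow> bool"
  where "rl_embedding A B f \<longleftrightarrow>
    f \<in> carrier A \<rightarrow> carrier B \<and> inj_on f (carrier A) \<and>
    f \<one>\<^bsub>A\<^esub> = \<one>\<^bsub>B\<^esub> \<and>
    (\<forall>x\<in>carrier A. \<forall>y\<in>carrier A.
      f (x \<curlywedge>\<^bsub>A\<^esub> y) = f x \<curlywedge>\<^bsub>B\<^esub> f y \<and>
      f (x \<curlyvee>\<^bsub>A\<^esub> y) = f x \<curlyvee>\<^bsub>B\<^esub> f y \<and>
      f (x \<otimes>\<^bsub>A\<^esub> y) = f x \<otimes>\<^bsub>B\<^esub> f y \<and>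
      f (ldiv A x y) = ldiv B (f x) (f y) \<and>
      f (rdiv A x y) = rdiv B (f x) (f y))"

text \<open>
  A class of algebras is represented by its members whose carrier is a subset of a type \<open>'u\<close>.
  For an isomorphism-closed class, an arbitrary infinite \<open>'u\<close> captures all members of
  cardinality at most that of \<open>'u\<close>. For finite \<open>'u\<close> the notion below is not the intended one,
  because the amalgam may simply not fit into \<open>'u\<close>.
\<close>

definition strong_amalgamation_property :: "'u rl_algebra set \<Rightarrow> bool"
  where "strong_amalgamation_property K \<longleftrightarrow>
    (\<forall>A\<in>K. \<forall>B\<in>K. \<forall>C\<in>K. \<forall>fB fC.
      rl_embedding A B fB \<and> rl_embedding A C fC \<longrightarrow>
      (\<exists>D\<in>K. \<exists>gB gC.
        rl_embedding B D gB \<and> rl_embedding C D gC \<and>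
        (\<forall>x\<in>carrier A. (gB \<circ> fB) x = (gC \<circ> fC) x) \<and>
        (gB \<circ> fB) ` carrier A = gB ` carrier B \<inter> gC ` carrier C))"

end

theory Submission
  imports Defs
begin

text \<open>
  In an idempotent residuated chain, \<open>x \<cdot> y\<close> is \<open>x \<and> y\<close> if \<open>x \<cdot> y \<le> 1\<close> and \<open>x \<or> y\<close> otherwise, so
  the algebra is determined by its order, its unit and the two negations
  \<open>l x = 1 / x\<close> and \<open>r x = x \ 1\<close>. If the star is an involution, then each of \<open>l x\<close>, \<open>r x\<close>
  is \<open>x\<^sup>\<star>\<close> or its upper cover. Hence \<open>B\<close> and \<open>C\<close> are amalgamated over \<open>A\<close> on the union
  of their chains, provided that the elements of \<open>B\<close> and of \<open>C\<close> filling the same cut of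
  \<open>A\<close> are not interleaved and that the order of the two blocks is reversed by the star.
\<close>

section \<open>Chains with a unit and two negations\<close>

text \<open>An idempotent residuated chain seen through its order, unit and negations. Both sides of
  \<open>galois\<close> stand for \<open>x \<cdot> y \<le> 1\<close>; \<open>l_le_r\<close> and
  \<open>r_le_l\<close> are the trace that associativity leaves on the negations.\<close>

locale neg_chain =
  fixes X :: "'a set" and le :: "'a \<Rightarrow> 'a \<Rightarrow> bool" and e :: 'a
    and l :: "'a \<Rightarrow> 'a" and r :: "'a \<Rightarrow> 'a"
  assumes refl: "x \<in> X \<Longrightarrow> le x x"
    and antisym: "\<lbrakk>x \<in> X; y \<in> X; le x y; le y x\<rbrakk> \<Longrightarrow> x = y"
    and trans: "\<lbrakk>x \<in> X; y \<in> X; z \<in> X; le x y; le y z\<rbrakk> \<Longrightarrow> le x z"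
    and total: "\<lbrakk>x \<in> X; y \<in> X\<rbrakk> \<Longrightarrow> le x y \<or> le y x"
    and e_closed: "e \<in> X"
    and l_closed: "x \<in> X \<Longrightarrow> l x \<in> X"
    and r_closed: "x \<in> X \<Longrightarrow> r x \<in> X"
    and galois: "\<lbrakk>x \<in> X; y \<in> X\<rbrakk> \<Longrightarrow> le x (l y) \<longleftrightarrow> le y (r x)"
    and l_e: "l e = e" and r_e: "r e = e"
    and l_le_r: "\<lbrakk>x \<in> X; z \<in> X; le x z; x \<noteq> z\<rbrakk> \<Longrightarrow> le (l z) (r x)"
    and r_le_l: "\<lbrakk>x \<in> X; z \<in> X; le x z; x \<noteq> z\<rbrakk> \<Longrightarrow> le (r z) (l x)"
begin

lemma l_antitone: "\<lbrakk>x \<in> X; y \<in> X; le x y\<rbrakk> \<Longrightarrow> le (l y) (l x)"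
  by (meson galois l_closed r_closed refl trans)

lemma r_antitone: "\<lbrakk>x \<in> X; y \<in> X; le x y\<rbrakk> \<Longrightarrow> le (r y) (r x)"
  by (meson galois l_closed r_closed refl trans)

text \<open>The last hypothesis puts \<open>y\<close> below a negation of \<open>z\<close>, and each
  negation of \<open>z\<close> lies below both negations of the strictly smaller \<open>x\<close>.
  In product terms: once \<open>y \<cdot> z\<close> or \<open>z \<cdot> y\<close> is at most the
  unit, so are both products of \<open>y\<close> with \<open>x\<close>.\<close>

lemma mult_neg_mono:
  assumes "x \<in> X" "y \<in> X" "z \<in> X" "le x z" "x \<noteq> z" "le y (r z) \<or> le z (r y)"
  shows "le y (r x) \<and> le x (r y)"
proof -
  have "le y (r z) \<or> le y (l z)"
    using assms galois by blast
  moreover have "le (r z) (l x)" "le (r z) (r x)" "le (l z) (l x)" "le (l z) (r x)"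
    using assms l_antitone r_antitone l_le_r r_le_l by simp_all
  ultimately have "le y (l x)" "le y (r x)"
    using assms trans[of y "r z" "l x"] trans[of y "r z" "r x"] trans[of y "l z" "l x"]
      trans[of y "l z" "r x"] l_closed r_closed by auto
  then show ?thesis
    using assms galois by simp
qed

text \<open>The condition \<open>y \<le> r x\<close> in \<open>mul\<close> says that the product is at most the unit.\<close>

definition mn where "mn x y = (if le x y then x else y)"
definition mx where "mx x y = (if le x y then y else x)"
definition s where "s x = mn (l x) (r x)"
definition mul where "mul x y = (if le y (r x) then mn x y else mx x y)"
text \<open>The formula solves \<open>le (mul x y) z\<close> for \<open>y\<close>: if
  \<open>x\<close> is below \<open>z\<close>, this holds exactly when \<open>y\<close> is below
  \<open>r x\<close> or below \<open>z\<close>; otherwise exactly when \<open>y\<close> is below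
  both.\<close>

definition ldv where "ldv x z = (if le x z then mx (r x) z else mn (r x) z)"
definition rdv where "rdv z y = (if le y z then mx (l y) z else mn (l y) z)"

section \<open>Lattice laws, associativity and residuation\<close>

lemma mn_closed: "\<lbrakk>x \<in> X; y \<in> X\<rbrakk> \<Longrightarrow> mn x y \<in> X"
  and mx_closed: "\<lbrakk>x \<in> X; y \<in> X\<rbrakk> \<Longrightarrow> mx x y \<in> X"
  by (simp_all add: mn_def mx_def)

lemma s_closed: "x \<in> X \<Longrightarrow> s x \<in> X"
  by (simp add: s_def mn_closed l_closed r_closed)

lemma mul_closed: "\<lbrakk>x \<in> X; y \<in> X\<rbrakk> \<Longrightarrow> mul x y \<in> X"
  by (simp add: mul_def mn_closed mx_closed)

lemma ldv_closed: "\<lbrakk>x \<in> X; y \<in> X\<rbrakk> \<Longrightarrow> ldv x y \<in> X"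
  and rdv_closed: "\<lbrakk>x \<in> X; y \<in> X\<rbrakk> \<Longrightarrow> rdv x y \<in> X"
  by (simp_all add: ldv_def rdv_def mn_closed mx_closed l_closed r_closed)

lemma le_mn_iff: "\<lbrakk>w \<in> X; x \<in> X; y \<in> X\<rbrakk> \<Longrightarrow> le w (mn x y) \<longleftrightarrow> le w x \<and> le w y"
  using total[of x y] trans[of w x y] trans[of w y x] by (auto simp: mn_def)

lemma mn_le_iff: "\<lbrakk>w \<in> X; x \<in> X; y \<in> X\<rbrakk> \<Longrightarrow> le (mn x y) w \<longleftrightarrow> le x w \<or> le y w"
  using total[of x y] trans[of x y w] trans[of y x w] by (auto simp: mn_def)

lemma le_mx_iff: "\<lbrakk>w \<in> X; x \<in> X; y \<in> X\<rbrakk> \<Longrightarrow> le w (mx x y) \<longleftrightarrow> le w x \<or> le w y"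
  using total[of x y] trans[of w x y] trans[of w y x] by (auto simp: mx_def)

lemma mx_le_iff: "\<lbrakk>w \<in> X; x \<in> X; y \<in> X\<rbrakk> \<Longrightarrow> le (mx x y) w \<longleftrightarrow> le x w \<and> le y w"
  using total[of x y] trans[of x y w] trans[of y x w] by (auto simp: mx_def)

lemma mn_assoc:
  assumes "x \<in> X" "y \<in> X" "z \<in> X"
  shows "mn (mn x y) z = mn x (mn y z)"
  using assms refl[of "mn (mn x y) z"] refl[of "mn x (mn y z)"]
  by (intro antisym) (simp_all add: mn_closed le_mn_iff)

lemma mx_assoc:
  assumes "x \<in> X" "y \<in> X" "z \<in> X"
  shows "mx (mx x y) z = mx x (mx y z)"
  using assms refl[of "mx (mx x y) z"] refl[of "mx x (mx y z)"]
  by (intro antisym) (simp_all add: mx_closed mx_le_iff)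

lemma mul_assoc:
  assumes "x \<in> X" "y \<in> X" "z \<in> X"
  shows "mul (mul x y) z = mul x (mul y z)"
proof -
  have tot: "le x y \<or> le y x" "le x z \<or> le z x" "le y z \<or> le z y"
    using total assms by auto
  have asym: "le x y \<and> le y x \<longrightarrow> x = y \<and> y = x" "le x z \<and> le z x \<longrightarrow> x = z \<and> z = x"
    "le y z \<and> le z y \<longrightarrow> y = z \<and> z = y"
    using antisym assms by auto
  have tr: "le x y \<and> le y z \<longrightarrow> le x z" "le x z \<and> le z y \<longrightarrow> le x y"
    "le y x \<and> le x z \<longrightarrow> le y z" "le y z \<and> le z x \<longrightarrow> le y x"
    "le z x \<and> le x y \<longrightarrow> le z y" "le z y \<and> le y x \<longrightarrow> le z x"
    using trans assms by blast+
  have neg: "le x y \<and> x \<noteq> y \<and> (le z (r y) \<or> le y (r z)) \<longrightarrow> le z (r x) \<and> le x (r z)"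
    "le x z \<and> x \<noteq> z \<and> (le y (r z) \<or> le z (r y)) \<longrightarrow> le y (r x) \<and> le x (r y)"
    "le y x \<and> y \<noteq> x \<and> (le z (r x) \<or> le x (r z)) \<longrightarrow> le z (r y) \<and> le y (r z)"
    "le y z \<and> y \<noteq> z \<and> (le x (r z) \<or> le z (r x)) \<longrightarrow> le x (r y) \<and> le y (r x)"
    "le z x \<and> z \<noteq> x \<and> (le y (r x) \<or> le x (r y)) \<longrightarrow> le y (r z) \<and> le z (r y)"
    "le z y \<and> z \<noteq> y \<and> (le x (r y) \<or> le y (r x)) \<longrightarrow> le x (r z) \<and> le z (r x)"
    using mult_neg_mono assms by blast+
  \<comment> \<open>The four comparisons decide the two inner products. The six instances of
    \<open>mult_neg_mono\<close> in \<open>neg\<close>, one for each strictly ordered pair, together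
    with the chain laws settle every way of evaluating the outer products.\<close>
  show ?thesis
    by (cases "le x y"; cases "le y z"; cases "le y (r x)"; cases "le z (r y)";
        (simp only: mul_def mn_def mx_def if_True if_False split: if_split)?;
        insert tot asym tr neg; blast)
qed

lemma mul_idem: "mul x x = x"
  by (simp add: mul_def mn_def mx_def)

lemma mul_e: "x \<in> X \<Longrightarrow> mul x e = x"
  unfolding mul_def mn_def mx_def
  by (metis e_closed galois l_e antisym total)

lemma e_mul: "x \<in> X \<Longrightarrow> mul e x = x"
  unfolding mul_def mn_def mx_def
  by (metis e_closed r_e antisym total)

lemma ldv_residuation:
  assumes "x \<in> X" "y \<in> X" "z \<in> X"
  shows "le y (ldv x z) \<longleftrightarrow> le (mul x y) z"
  using assms
  by (simp add: mul_def ldv_def le_mn_iff mn_le_iff le_mx_iff mx_le_iff r_closed)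

lemma rdv_residuation:
  assumes "x \<in> X" "y \<in> X" "z \<in> X"
  shows "le (mul x y) z \<longleftrightarrow> le x (rdv z y)"
  using assms
  by (auto simp: mul_def rdv_def le_mn_iff mn_le_iff le_mx_iff mx_le_iff l_closed galois)

text \<open>Antitonicity and \<open>r e = e\<close> put \<open>r x\<close> on the side of
  \<open>e\<close> opposite to \<open>x\<close>, which is where the join or meet with
  \<open>e\<close> returns \<open>r x\<close>.\<close>

lemma ldv_e: "x \<in> X \<Longrightarrow> ldv x e = r x"
  unfolding ldv_def mn_def mx_def
  by (metis e_closed r_e r_antitone antisym r_closed total)

lemma rdv_e: "x \<in> X \<Longrightarrow> rdv e x = l x"
  unfolding rdv_def mn_def mx_def
  by (metis e_closed l_e l_antitone antisym l_closed total)

section \<open>The residuated chain given by order, unit and negations\<close>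

definition alg :: "'a rl_algebra" where
  "alg = \<lparr>carrier = X, mult = mul, one = e, rmeet = mn, rjoin = mx, ldiv = ldv, rdiv = rdv\<rparr>"

lemma alg_sel [simp]:
  "carrier alg = X" "mult alg = mul" "one alg = e" "rmeet alg = mn" "rjoin alg = mx"
  "ldiv alg = ldv" "rdiv alg = rdv"
  by (simp_all add: alg_def)

lemma rle_alg: "\<lbrakk>x \<in> X; y \<in> X\<rbrakk> \<Longrightarrow> rle alg x y \<longleftrightarrow> le x y"
  by (auto simp: rle_def mn_def refl)

lemma neg_alg: "x \<in> X \<Longrightarrow> lneg alg x = l x" "x \<in> X \<Longrightarrow> rneg alg x = r x"
  by (simp_all add: lneg_def rneg_def ldv_e rdv_e)

lemma star_alg: "x \<in> X \<Longrightarrow> star alg x = s x"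
  by (simp add: star_def neg_alg s_def)

lemma alg_chain: "idempotent_residuated_chain alg"
proof unfold_locales
  show "x \<otimes>\<^bsub>alg\<^esub> y \<otimes>\<^bsub>alg\<^esub> z = x \<otimes>\<^bsub>alg\<^esub> (y \<otimes>\<^bsub>alg\<^esub> z)"
    if "x \<in> carrier alg" "y \<in> carrier alg" "z \<in> carrier alg" for x y z
    using that by (simp add: mul_assoc)
  show "x \<curlywedge>\<^bsub>alg\<^esub> y \<curlywedge>\<^bsub>alg\<^esub> z = x \<curlywedge>\<^bsub>alg\<^esub> (y \<curlywedge>\<^bsub>alg\<^esub> z)"
    if "x \<in> carrier alg" "y \<in> carrier alg" "z \<in> carrier alg" for x y z
    using that by (simp add: mn_assoc)
  show "x \<curlyvee>\<^bsub>alg\<^esub> y \<curlyvee>\<^bsub>alg\<^esub> z = x \<curlyvee>\<^bsub>alg\<^esub> (y \<curlyvee>\<^bsub>alg\<^esub> z)"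
    if "x \<in> carrier alg" "y \<in> carrier alg" "z \<in> carrier alg" for x y z
    using that by (simp add: mx_assoc)
  show "x \<curlywedge>\<^bsub>alg\<^esub> y = y \<curlywedge>\<^bsub>alg\<^esub> x" "x \<curlyvee>\<^bsub>alg\<^esub> y = y \<curlyvee>\<^bsub>alg\<^esub> x"
    "x \<curlywedge>\<^bsub>alg\<^esub> (x \<curlyvee>\<^bsub>alg\<^esub> y) = x" "x \<curlyvee>\<^bsub>alg\<^esub> (x \<curlywedge>\<^bsub>alg\<^esub> y) = x"
    if "x \<in> carrier alg" "y \<in> carrier alg" for x y
    using that total[of x y] antisym[of x y] by (auto simp: mn_def mx_def)
  show "x \<preceq>\<^bsub>alg\<^esub> y \<or> y \<preceq>\<^bsub>alg\<^esub> x" if "x \<in> carrier alg" "y \<in> carrier alg" for x y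
    using that total by (simp add: rle_alg)
  show "y \<preceq>\<^bsub>alg\<^esub> ldiv alg x z \<longleftrightarrow> x \<otimes>\<^bsub>alg\<^esub> y \<preceq>\<^bsub>alg\<^esub> z"
    "x \<otimes>\<^bsub>alg\<^esub> y \<preceq>\<^bsub>alg\<^esub> z \<longleftrightarrow> x \<preceq>\<^bsub>alg\<^esub> rdiv alg z y"
    if "x \<in> carrier alg" "y \<in> carrier alg" "z \<in> carrier alg" for x y z
    using that ldv_residuation[of x y z] rdv_residuation[of x y z]
    by (simp_all add: rle_alg mul_closed ldv_closed rdv_closed)
qed (simp_all add: mul_closed mn_closed mx_closed ldv_closed rdv_closed e_closed
      mul_e e_mul mul_idem)

end

section \<open>From idempotent residuated chains to chains with negations\<close>

context residuated_lattice
begin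

lemma meet_idem: "x \<in> carrier A \<Longrightarrow> x \<curlywedge> x = x"
  by (metis join_meet_absorb meet_closed meet_join_absorb)

lemma rle_refl: "x \<in> carrier A \<Longrightarrow> x \<preceq> x"
  by (simp add: rle_def meet_idem)

lemma rle_antisym: "\<lbrakk>x \<in> carrier A; y \<in> carrier A; x \<preceq> y; y \<preceq> x\<rbrakk> \<Longrightarrow> x = y"
  by (metis rle_def meet_comm)

lemma rle_trans:
  "\<lbrakk>x \<in> carrier A; y \<in> carrier A; z \<in> carrier A; x \<preceq> y; y \<preceq> z\<rbrakk> \<Longrightarrow> x \<preceq> z"
  by (metis rle_def meet_assoc)

lemma join_eq: "\<lbrakk>x \<in> carrier A; y \<in> carrier A; x \<preceq> y\<rbrakk> \<Longrightarrow> x \<curlyvee> y = y"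
  by (metis rle_def meet_comm join_comm join_meet_absorb)

lemma mult_left_mono:
  "\<lbrakk>x \<in> carrier A; y \<in> carrier A; z \<in> carrier A; x \<preceq> y\<rbrakk> \<Longrightarrow> z \<otimes> x \<preceq> z \<otimes> y"
  by (meson ldiv_closed ldiv_residuation m_closed rle_refl rle_trans)

lemma mult_right_mono:
  "\<lbrakk>x \<in> carrier A; y \<in> carrier A; z \<in> carrier A; x \<preceq> y\<rbrakk> \<Longrightarrow> x \<otimes> z \<preceq> y \<otimes> z"
  by (meson rdiv_closed rdiv_residuation m_closed rle_refl rle_trans)

end

context idempotent_residuated_chain
begin

text \<open>If \<open>x\<close> is the smaller factor, then
  \<open>x = x \<cdot> x \<le> x \<cdot> y\<close>, and
  \<open>x \<cdot> y = x \<cdot> (x \<cdot> y) \<le> x \<cdot> 1\<close>. If \<open>y\<close> is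
  smaller, multiply on the right instead.\<close>

lemma mult_eq_meet:
  assumes x: "x \<in> carrier A" and y: "y \<in> carrier A" and le: "x \<otimes> y \<preceq> \<one>"
  shows "x \<otimes> y = x \<curlywedge> y"
proof (cases "x \<preceq> y")
  case True
  have "x \<preceq> x \<otimes> y"
    using mult_left_mono[OF x y x True] idempotent x by simp
  moreover have "x \<otimes> y \<preceq> x"
    using mult_left_mono[OF _ _ x le] x y by (simp add: m_assoc[symmetric] idempotent)
  ultimately show ?thesis
    using True x y rle_antisym by (simp add: rle_def)
next
  case False
  then have yx: "y \<preceq> x" using total x y by blast
  have "y \<preceq> x \<otimes> y"
    using mult_right_mono[OF y x y yx] idempotent y by simp
  moreover have "x \<otimes> y \<preceq> y"
    using mult_right_mono[OF _ _ y le] x y by (simp add: m_assoc idempotent)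
  ultimately show ?thesis
    using yx x y rle_antisym by (metis m_closed meet_comm rle_def)
qed

text \<open>Dual to \<open>mult_eq_meet\<close>, with the larger factor in place of the smaller
  one.\<close>

lemma mult_eq_join:
  assumes x: "x \<in> carrier A" and y: "y \<in> carrier A" and ge: "\<one> \<preceq> x \<otimes> y"
  shows "x \<otimes> y = x \<curlyvee> y"
proof (cases "x \<preceq> y")
  case True
  have "x \<otimes> y \<preceq> y"
    using mult_right_mono[OF x y y True] idempotent y by simp
  moreover have "y \<preceq> x \<otimes> y"
    using mult_right_mono[OF _ _ y ge] x y by (simp add: m_assoc idempotent)
  ultimately show ?thesis
    using True x y rle_antisym by (metis m_closed join_eq)
next
  case False
  then have yx: "y \<preceq> x" using total x y by blast
  have "x \<otimes> y \<preceq> x"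
    using mult_left_mono[OF y x x yx] idempotent x by simp
  moreover have "x \<preceq> x \<otimes> y"
    using mult_left_mono[OF _ _ x ge] x y by (simp add: m_assoc[symmetric] idempotent)
  ultimately show ?thesis
    using yx x y rle_antisym by (metis m_closed join_eq join_comm)
qed

lemma rneg_closed: "x \<in> carrier A \<Longrightarrow> rneg A x \<in> carrier A"
  and lneg_closed: "x \<in> carrier A \<Longrightarrow> lneg A x \<in> carrier A"
  by (simp_all add: rneg_def lneg_def ldiv_closed rdiv_closed)

lemma le_rneg_iff: "\<lbrakk>x \<in> carrier A; y \<in> carrier A\<rbrakk> \<Longrightarrow> y \<preceq> rneg A x \<longleftrightarrow> x \<otimes> y \<preceq> \<one>"
  and le_lneg_iff: "\<lbrakk>x \<in> carrier A; y \<in> carrier A\<rbrakk> \<Longrightarrow> x \<preceq> lneg A y \<longleftrightarrow> x \<otimes> y \<preceq> \<one>"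
  by (simp_all add: rneg_def lneg_def ldiv_residuation rdiv_residuation)

text \<open>Were \<open>x \<cdot> y\<close> above the unit, it would be a join while
  \<open>y \<cdot> z\<close> is a meet. Evaluating both sides of
  \<open>(x \<cdot> y) \<cdot> z = x \<cdot> (y \<cdot> z)\<close> then either contradicts the
  assumption on \<open>x \<cdot> y\<close> or makes \<open>x \<cdot> z\<close> equal to
  \<open>z\<close> where it must be the meet, or to \<open>x\<close> where it must be the
  join.\<close>

lemma left_mult_le_one:
  assumes x: "x \<in> carrier A" and y: "y \<in> carrier A" and z: "z \<in> carrier A"
    and xz: "x \<preceq> z" "x \<noteq> z" and yz: "y \<otimes> z \<preceq> \<one>"
  shows "x \<otimes> y \<preceq> \<one>"
proof (rule ccontr)
  assume n: "\<not> x \<otimes> y \<preceq> \<one>"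
  have xy: "x \<otimes> y = x \<curlyvee> y"
    using n mult_eq_join total x y by blast
  have yz': "y \<otimes> z = y \<curlywedge> z" using mult_eq_meet y z yz by blast
  have as: "(x \<otimes> y) \<otimes> z = x \<otimes> (y \<otimes> z)" using m_assoc x y z by blast
  show False
  proof (cases "x \<preceq> y")
    case True
    then have "x \<otimes> y = y" using xy x y join_eq by simp
    then have "y \<otimes> z = x \<otimes> (y \<curlywedge> z)" using as yz' by simp
    moreover have "y \<curlywedge> z = y \<or> y \<curlywedge> z = z"
      using total[OF y z] y z by (metis rle_def meet_comm)
    ultimately have "x \<otimes> z = z" "z \<preceq> \<one>" using n yz yz' by auto
    moreover then have "x \<otimes> z = x \<curlywedge> z" using mult_eq_meet x z by simp
    ultimately show False using xz by (simp add: rle_def)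
  next
    case False
    then have yx: "y \<preceq> x" using total x y by blast
    then have 1: "x \<otimes> y = x" using xy x y join_eq join_comm by metis
    have "y \<preceq> z" using yx xz x y z rle_trans by blast
    then have "x \<otimes> z = x" using as 1 yz' by (simp add: rle_def)
    moreover then have "x \<otimes> z = x \<curlyvee> z" using mult_eq_join total n 1 x z by (metis one_closed)
    ultimately show False using xz x z join_eq by simp
  qed
qed

text \<open>Mirror image of \<open>left_mult_le_one\<close>, comparing
  \<open>(z \<cdot> y) \<cdot> x\<close> with \<open>z \<cdot> (y \<cdot> x)\<close>.\<close>

lemma right_mult_le_one:
  assumes x: "x \<in> carrier A" and y: "y \<in> carrier A" and z: "z \<in> carrier A"
    and xz: "x \<preceq> z" "x \<noteq> z" and zy: "z \<otimes> y \<preceq> \<one>"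
  shows "y \<otimes> x \<preceq> \<one>"
proof (rule ccontr)
  assume n: "\<not> y \<otimes> x \<preceq> \<one>"
  have yx: "y \<otimes> x = y \<curlyvee> x"
    using n mult_eq_join total x y by blast
  have zy': "z \<otimes> y = z \<curlywedge> y" using mult_eq_meet y z zy by blast
  have as: "(z \<otimes> y) \<otimes> x = z \<otimes> (y \<otimes> x)" using m_assoc x y z by blast
  show False
  proof (cases "x \<preceq> y")
    case True
    then have "y \<otimes> x = y" using yx x y join_eq join_comm by metis
    then have "z \<otimes> y = (z \<curlywedge> y) \<otimes> x" using as zy' by simp
    moreover have "z \<curlywedge> y = y \<or> z \<curlywedge> y = z"
      using total[OF y z] y z by (metis rle_def meet_comm)
    ultimately have "z \<otimes> x = z" "z \<preceq> \<one>" using n zy zy' by auto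
    moreover then have "z \<otimes> x = z \<curlywedge> x" using mult_eq_meet x z by simp
    ultimately show False using xz x z by (metis rle_def meet_comm)
  next
    case False
    then have le: "y \<preceq> x" using total x y by blast
    then have 1: "y \<otimes> x = x" using yx x y join_eq by metis
    have "y \<preceq> z" using le xz x y z rle_trans by blast
    then have "z \<otimes> x = x" using as 1 zy' y z by (metis rle_def meet_comm)
    moreover then have "z \<otimes> x = z \<curlyvee> x" using mult_eq_join total n 1 x z by (metis one_closed)
    ultimately show False using xz x z join_eq join_comm by metis
  qed
qed

lemma neg_chain: "neg_chain (carrier A) (rle A) \<one> (lneg A) (rneg A)"
proof
  show "lneg A \<one> = \<one>" "rneg A \<one> = \<one>"
    by (metis le_lneg_iff le_rneg_iff l_one r_one lneg_closed rneg_closed one_closed rle_antisym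
        rle_refl)+
  fix x z assume a: "x \<in> carrier A" "z \<in> carrier A" "x \<preceq> z" "x \<noteq> z"
  \<comment> \<open>The product of \<open>lneg A z\<close> with \<open>z\<close> is at most the
    unit, so \<open>lneg A z\<close> can be the \<open>y\<close> of \<open>left_mult_le_one\<close>;
    the next claim uses \<open>rneg A z\<close> dually.\<close>
  show "lneg A z \<preceq> rneg A x"
    using left_mult_le_one[of x "lneg A z" z] a
    by (simp add: le_rneg_iff le_lneg_iff[symmetric] lneg_closed rle_refl)
  show "rneg A z \<preceq> lneg A x"
    using right_mult_le_one[of x "rneg A z" z] a
    by (simp add: le_lneg_iff le_rneg_iff[symmetric] rneg_closed rle_refl)
qed (auto simp: rle_refl total lneg_closed rneg_closed le_lneg_iff le_rneg_iff
    intro: rle_antisym rle_trans)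

interpretation neg: neg_chain "carrier A" "rle A" "\<one>" "lneg A" "rneg A"
  by (rule neg_chain)

lemma meet_eq_mn: "\<lbrakk>x \<in> carrier A; y \<in> carrier A\<rbrakk> \<Longrightarrow> x \<curlywedge> y = neg.mn x y"
  unfolding neg.mn_def by (metis total rle_def meet_comm)

lemma join_eq_mx: "\<lbrakk>x \<in> carrier A; y \<in> carrier A\<rbrakk> \<Longrightarrow> x \<curlyvee> y = neg.mx x y"
  unfolding neg.mx_def by (metis total join_eq join_comm)

lemma mult_eq_mul: "\<lbrakk>x \<in> carrier A; y \<in> carrier A\<rbrakk> \<Longrightarrow> x \<otimes> y = neg.mul x y"
  unfolding neg.mul_def
  by (metis le_rneg_iff meet_eq_mn join_eq_mx mult_eq_meet mult_eq_join total m_closed one_closed)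

text \<open>Both are residuals of the same product, and residuals are unique.\<close>

lemma ldiv_eq_ldv: "\<lbrakk>x \<in> carrier A; y \<in> carrier A\<rbrakk> \<Longrightarrow> ldiv A x y = neg.ldv x y"
  by (metis neg.ldv_residuation neg.ldv_closed ldiv_residuation ldiv_closed mult_eq_mul
      rle_antisym rle_refl)

lemma rdiv_eq_rdv: "\<lbrakk>x \<in> carrier A; y \<in> carrier A\<rbrakk> \<Longrightarrow> rdiv A x y = neg.rdv x y"
  by (metis neg.rdv_residuation neg.rdv_closed rdiv_residuation rdiv_closed mult_eq_mul
      rle_antisym rle_refl)

lemma star_eq_s: "x \<in> carrier A \<Longrightarrow> star A x = neg.s x"
  by (simp add: star_def neg.s_def meet_eq_mn lneg_closed rneg_closed)

end

section \<open>Embeddings in terms of order and negations\<close>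

text \<open>All operations are case distinctions on the order applied to arguments and their
  negations, so a map respecting these data respects everything. Conversely, injectivity turns
  preservation of meets into reflection of the order.\<close>

lemma rl_embedding_iff:
  assumes "idempotent_residuated_chain A" "idempotent_residuated_chain B"
  shows "rl_embedding A B f \<longleftrightarrow>
    f \<in> carrier A \<rightarrow> carrier B \<and> f \<one>\<^bsub>A\<^esub> = \<one>\<^bsub>B\<^esub> \<and>
    (\<forall>x\<in>carrier A. \<forall>y\<in>carrier A. f x \<preceq>\<^bsub>B\<^esub> f y \<longleftrightarrow> x \<preceq>\<^bsub>A\<^esub> y) \<and>
    (\<forall>x\<in>carrier A. f (lneg A x) = lneg B (f x) \<and> f (rneg A x) = rneg B (f x))"
    (is "_ \<longleftrightarrow> ?R")
proof
  interpret A: idempotent_residuated_chain A by fact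
  interpret B: idempotent_residuated_chain B by fact
  show ?R if "rl_embedding A B f"
  proof -
    have i: "inj_on f (carrier A)" and 1: "f \<one>\<^bsub>A\<^esub> = \<one>\<^bsub>B\<^esub>"
      and m: "\<And>x y. \<lbrakk>x \<in> carrier A; y \<in> carrier A\<rbrakk> \<Longrightarrow> f (x \<curlywedge>\<^bsub>A\<^esub> y) = f x \<curlywedge>\<^bsub>B\<^esub> f y"
      using that by (auto simp: rl_embedding_def)
    have "f x \<preceq>\<^bsub>B\<^esub> f y \<longleftrightarrow> x \<preceq>\<^bsub>A\<^esub> y" if "x \<in> carrier A" "y \<in> carrier A" for x y
      using that m[OF that] i by (metis A.meet_closed inj_onD rle_def)
    then show ?thesis
      using that 1 by (auto simp: rl_embedding_def lneg_def rneg_def)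
  qed
  assume R: ?R
  interpret NA: neg_chain "carrier A" "rle A" "\<one>\<^bsub>A\<^esub>" "lneg A" "rneg A"
    by (rule A.neg_chain)
  interpret NB: neg_chain "carrier B" "rle B" "\<one>\<^bsub>B\<^esub>" "lneg B" "rneg B"
    by (rule B.neg_chain)
  have f: "f x \<in> carrier B" if "x \<in> carrier A" for x using R that by auto
  have inj: "inj_on f (carrier A)"
    by (rule inj_onI) (metis R A.rle_antisym A.rle_refl)
  \<comment> \<open>The flipped rule rewrites negations of \<open>f x\<close> as images under
    \<open>f\<close>, so that every comparison in \<open>B\<close> is pulled back to one in
    \<open>A\<close>.\<close>
  show "rl_embedding A B f"
    unfolding rl_embedding_def
    using R inj
    by (auto simp: A.meet_eq_mn B.meet_eq_mn A.join_eq_mx B.join_eq_mx A.mult_eq_mul B.mult_eq_mul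
        A.ldiv_eq_ldv B.ldiv_eq_ldv A.rdiv_eq_rdv B.rdiv_eq_rdv f
        NA.mn_def NB.mn_def NA.mx_def NB.mx_def NA.mul_def NB.mul_def NA.ldv_def NB.ldv_def
        NA.rdv_def NB.rdv_def A.rneg_closed A.lneg_closed
        simp flip: R[THEN conjunct2, THEN conjunct2, THEN conjunct2, rule_format])
qed

section \<open>Negations as covers of the star\<close>

locale star_chain = neg_chain +
  assumes s_s: "x \<in> X \<Longrightarrow> s (s x) = x"
begin

lemma alg_star_chain: "star_involutive_idempotent_residuated_chain alg"
  unfolding star_involutive_idempotent_residuated_chain_def
    star_involutive_idempotent_residuated_chain_axioms_def
  by (simp add: alg_chain star_alg s_closed s_s)

lemma s_antitone: "\<lbrakk>x \<in> X; y \<in> X; le x y\<rbrakk> \<Longrightarrow> le (s y) (s x)"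
  by (simp add: s_def le_mn_iff mn_le_iff mn_closed l_closed r_closed l_antitone r_antitone)

lemma s_le_iff: "\<lbrakk>x \<in> X; y \<in> X\<rbrakk> \<Longrightarrow> le (s y) (s x) \<longleftrightarrow> le x y"
  by (metis s_antitone s_closed s_s)

lemma s_e: "s e = e"
  by (simp add: s_def mn_def l_e r_e)

lemma s_le_neg:
  assumes "x \<in> X" "w = l x \<or> w = r x"
  shows "le (s x) w"
  using assms unfolding s_def mn_def by (metis l_closed r_closed refl total)

text \<open>If \<open>a\<close> is strictly above \<open>s x\<close>, then \<open>s a\<close> is
  strictly below \<open>x\<close>, so each negation of \<open>x\<close> lies below both negations of
  \<open>s a\<close>. Hence \<open>w\<close> is below \<open>s (s a) = a\<close>.\<close>

lemma neg_cover:
  assumes x: "x \<in> X" and w: "w = l x \<or> w = r x" and a: "a \<in> X" "le (s x) a" "le a w"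
  shows "a = s x \<or> a = w"
proof (rule disjCI)
  assume n: "a \<noteq> w"
  have wX: "w \<in> X" using w x l_closed r_closed by auto
  show "a = s x"
  proof (rule ccontr)
    assume n': "a \<noteq> s x"
    have sa: "s a \<in> X" "s a \<noteq> x" "le (s a) x"
      using a n' x by (auto simp: s_closed s_s) (metis s_antitone s_closed s_s)
    have "le w (l (s a))" "le w (r (s a))"
      using w l_le_r[OF sa(1) x sa(3,2)] r_le_l[OF sa(1) x sa(3,2)]
        l_antitone[OF sa(1) x sa(3)] r_antitone[OF sa(1) x sa(3)] by auto
    then have "le w (s (s a))"
      unfolding s_def[of "s a"] mn_def by simp
    then show False using n a wX antisym s_s by metis
  qed
qed

text \<open>The Galois law puts \<open>x\<close> below a negation \<open>v\<close> of
  \<open>w\<close>, and \<open>s w\<close> lies below \<open>x\<close>. By \<open>neg_cover\<close>,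
  \<open>x\<close> is \<open>s w\<close> or \<open>v\<close>, both of which are in
  \<open>S\<close>.\<close>

lemma neg_in_subalgebra:
  assumes x: "x \<in> X" and S: "S \<subseteq> X" "\<And>a. a \<in> S \<Longrightarrow> l a \<in> S \<and> r a \<in> S"
    and w: "w = l x \<or> w = r x" "w \<in> S"
  shows "x \<in> S"
proof -
  have wX: "w \<in> X" and lw: "l w \<in> S" "r w \<in> S" "s w \<in> S" using w S by (auto simp: s_def mn_def)
  obtain v where v: "v = l w \<or> v = r w" "le x v"
    using w x wX galois[of x w] galois[of w x] refl by metis
  have "le (s w) x"
    using s_antitone[of "s x" w] s_le_neg[OF x w(1)] x wX by (simp add: s_s s_closed)
  from neg_cover[OF wX v(1) x this v(2)] show ?thesis
    using lw v(1) by auto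
qed

end

lemma (in star_involutive_idempotent_residuated_chain) star_chain:
  "star_chain (carrier A) (rle A) \<one> (lneg A) (rneg A)"
proof -
  interpret neg: neg_chain "carrier A" "rle A" "\<one>" "lneg A" "rneg A"
    by (rule neg_chain)
  show ?thesis
    by unfold_locales (metis star_eq_s star_involutive neg.s_closed)
qed

text \<open>Transport of structure, used to move two chains into a common type where their carriers
  overlap as prescribed.\<close>

lemma star_chain_image:
  fixes X :: "'a set" and le :: "'a \<Rightarrow> 'a \<Rightarrow> bool" and g :: "'a \<Rightarrow> 'b"
  assumes "star_chain X le e l r" and g: "inj_on g X"
  defines "h \<equiv> inv_into X g"
  shows "star_chain (g ` X) (\<lambda>u v. le (h u) (h v)) (g e) (g \<circ> l \<circ> h) (g \<circ> r \<circ> h)"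
proof -
  interpret star_chain X le e l r by fact
  have h [simp]: "h (g x) = x" if "x \<in> X" for x
    using that g by (simp add: h_def)
  interpret N: neg_chain "g ` X" "\<lambda>u v. le (h u) (h v)" "g e" "g \<circ> l \<circ> h" "g \<circ> r \<circ> h"
  proof
    show "u = v" if "u \<in> g ` X" "v \<in> g ` X" "le (h u) (h v)" "le (h v) (h u)" for u v
      using that antisym by (metis h imageE)
    show "le (h u) (h v) \<or> le (h v) (h u)" if "u \<in> g ` X" "v \<in> g ` X" for u v
      using that total[of "h u" "h v"] by auto
    show "le (h u) (h ((g \<circ> l \<circ> h) v)) \<longleftrightarrow> le (h v) (h ((g \<circ> r \<circ> h) u))"
      if "u \<in> g ` X" "v \<in> g ` X" for u v
      using that by (auto simp: l_closed r_closed galois)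
    show "le (h ((g \<circ> l \<circ> h) v)) (h ((g \<circ> r \<circ> h) u))"
      "le (h ((g \<circ> r \<circ> h) v)) (h ((g \<circ> l \<circ> h) u))"
      if "u \<in> g ` X" "v \<in> g ` X" "le (h u) (h v)" "u \<noteq> v" for u v
      using that by (auto simp: l_closed r_closed intro: l_le_r r_le_l)
  qed (auto simp: refl l_closed r_closed e_closed l_e r_e intro: trans)
  have "N.s (g x) = g (s x)" if "x \<in> X" for x
    using that unfolding N.s_def s_def mn_def N.mn_def by (simp add: l_closed r_closed)
  then show ?thesis
    by unfold_locales (auto simp: s_closed s_s)
qed

section \<open>Two chains sharing a subalgebra, and the order on their union\<close>

text \<open>The intersection of the carriers is the common subalgebra: where the negations agree,
  their values lie in both carriers.\<close>

locale star_chain_amalgam =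
  B: star_chain B leB e lB rB + C: star_chain C leC e lC rC
  for B :: "'a set" and leB e lB rB C leC lC rC +
  assumes le_agree: "\<lbrakk>x \<in> B \<inter> C; y \<in> B \<inter> C\<rbrakk> \<Longrightarrow> leB x y \<longleftrightarrow> leC x y"
    and l_agree: "x \<in> B \<inter> C \<Longrightarrow> lB x = lC x"
    and r_agree: "x \<in> B \<inter> C \<Longrightarrow> rB x = rC x"
begin

lemma l_Int: "x \<in> B \<inter> C \<Longrightarrow> lB x \<in> B \<inter> C" "x \<in> B \<inter> C \<Longrightarrow> lC x \<in> B \<inter> C"
  and r_Int: "x \<in> B \<inter> C \<Longrightarrow> rB x \<in> B \<inter> C" "x \<in> B \<inter> C \<Longrightarrow> rC x \<in> B \<inter> C"
  using B.l_closed B.r_closed C.l_closed C.r_closed l_agree r_agree by (metis IntE IntI)+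

lemma s_agree: "x \<in> B \<inter> C \<Longrightarrow> B.s x = C.s x"
  using l_agree[of x] r_agree[of x] l_Int[of x] r_Int[of x] le_agree[of "lB x" "rB x"]
  by (simp add: B.s_def C.s_def B.mn_def C.mn_def)

lemma s_Int: "x \<in> B \<inter> C \<Longrightarrow> B.s x \<in> B \<inter> C"
  using B.s_closed C.s_closed s_agree by (metis IntE IntI)

lemma e_Int: "e \<in> B \<inter> C"
  by (simp add: B.e_closed C.e_closed)

text \<open>
  Elements of \<open>B\<close> and \<open>C\<close> in the same cut of \<open>B \<inter> C\<close> are ordered with \<open>B\<close> below \<open>C\<close>
  above the unit and conversely below it: the star then stays antitone, and no covering pair
  \<open>s x < l x\<close> or \<open>s x < r x\<close> is broken up.
\<close>

definition cross :: "'a \<Rightarrow> 'a \<Rightarrow> bool" where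
  "cross b c \<longleftrightarrow> (\<exists>a\<in>B \<inter> C. leB b a \<and> leC a c) \<or>
    (leB e b \<and> \<not> (\<exists>a\<in>B \<inter> C. leC c a \<and> leB a b))"

text \<open>Common elements are treated as elements of \<open>B\<close>; \<open>leD_C\<close> shows
  that this is compatible with \<open>leC\<close>. Comparing from \<open>C\<close> to
  \<open>B\<close> by the negation of \<open>cross\<close> makes totality and antisymmetry of mixed
  pairs automatic.\<close>

definition leD :: "'a \<Rightarrow> 'a \<Rightarrow> bool" where
  "leD x y \<longleftrightarrow> (if x \<in> B then if y \<in> B then leB x y else cross x y
    else if y \<in> B then \<not> cross y x else leC x y)"

definition lD where "lD x = (if x \<in> B then lB x else lC x)"
definition rD where "rD x = (if x \<in> B then rB x else rC x)"

lemma cross_mono_right: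
  assumes b: "b \<in> B" and c: "c \<in> C" "c' \<in> C" "leC c c'" and h: "cross b c"
  shows "cross b c'"
  using h b c C.trans unfolding cross_def by blast

lemma cross_antimono_left:
  assumes b: "b \<in> B" "b' \<in> B" "leB b' b" and c: "c \<in> C" and h: "cross b c"
  shows "cross b' c"
proof (cases "\<exists>a\<in>B \<inter> C. leB b a \<and> leC a c")
  case True
  then show ?thesis using b B.trans unfolding cross_def by blast
next
  case False
  then have eb: "leB e b" and n: "\<not> (\<exists>a\<in>B \<inter> C. leC c a \<and> leB a b)"
    using h by (auto simp: cross_def)
  have n': "\<not> (\<exists>a\<in>B \<inter> C. leC c a \<and> leB a b')"
    using n b B.trans by blast
  show ?thesis
  proof (cases "leB e b'")
    case True
    then show ?thesis using n' by (simp add: cross_def)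
  next
    case False
    \<comment> \<open>Here \<open>b'\<close> falls below the unit and the default clause no longer
      covers it, but \<open>e\<close> itself separates \<open>b'\<close> from
      \<open>c\<close>.\<close>
    then have "leB b' e" using b B.total B.e_closed by blast
    moreover have "leC e c" using n eb e_Int C.total c by blast
    ultimately show ?thesis using e_Int by (auto simp: cross_def)
  qed
qed

text \<open>The common element \<open>b\<close> is its own separator, so the default clause of
  \<open>cross\<close> never decides.\<close>

lemma cross_left_Int:
  assumes b: "b \<in> B \<inter> C" and c: "c \<in> C"
  shows "cross b c \<longleftrightarrow> leC b c"
proof
  assume h: "cross b c"
  show "leC b c"
  proof (cases "\<exists>a\<in>B \<inter> C. leB b a \<and> leC a c")
    case True
    then show ?thesis using b c le_agree C.trans by blast
  next
    case False
    then show ?thesis using h b c C.total B.refl unfolding cross_def by blast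
  qed
qed (use b B.refl in \<open>auto simp: cross_def\<close>)

lemma leD_B: "\<lbrakk>x \<in> B; y \<in> B\<rbrakk> \<Longrightarrow> leD x y \<longleftrightarrow> leB x y"
  by (simp add: leD_def)

lemma leD_C:
  assumes "x \<in> C" "y \<in> C"
  shows "leD x y \<longleftrightarrow> leC x y"
proof -
  have "\<not> cross y x \<longleftrightarrow> leC x y" if "y \<in> B" "x \<notin> B"
    using cross_left_Int[of y x] assms that C.total[of x y] C.antisym[of x y] by auto
  then show ?thesis
    using assms cross_left_Int[of x y] le_agree[of x y] by (auto simp: leD_def)
qed

lemma leD_cross: "\<lbrakk>x \<in> B; y \<in> C - B\<rbrakk> \<Longrightarrow> leD x y \<longleftrightarrow> cross x y"
  "\<lbrakk>x \<in> C - B; y \<in> B\<rbrakk> \<Longrightarrow> leD x y \<longleftrightarrow> \<not> cross y x"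
  by (auto simp: leD_def)

lemma lD_rD_C: "x \<in> C \<Longrightarrow> lD x = lC x" "x \<in> C \<Longrightarrow> rD x = rC x"
  by (simp_all add: lD_def rD_def l_agree r_agree)

text \<open>Contrapositive of \<open>B.neg_in_subalgebra\<close> for the subalgebra
  \<open>B \<inter> C\<close>.\<close>

lemma neg_outside_B:
  assumes "b \<in> B - C" "w = lB b \<or> w = rB b"
  shows "w \<in> B - C"
proof -
  have "w \<in> B" using assms B.l_closed[of b] B.r_closed[of b] by auto
  moreover have "w \<notin> B \<inter> C"
    using assms B.neg_in_subalgebra[of b "B \<inter> C" w] l_Int r_Int by auto
  ultimately show ?thesis using assms by auto
qed

lemma neg_outside_C:
  assumes "c \<in> C - B" "w = lC c \<or> w = rC c"
  shows "w \<in> C - B"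
proof -
  have "w \<in> C" using assms C.l_closed[of c] C.r_closed[of c] by auto
  moreover have "w \<notin> B \<inter> C"
    using assms C.neg_in_subalgebra[of c "B \<inter> C" w] l_Int r_Int by auto
  ultimately show ?thesis using assms by auto
qed

lemma s_outside_B: "b \<in> B - C \<Longrightarrow> B.s b \<in> B - C"
  by (rule neg_outside_B) (auto simp: B.s_def B.mn_def)

lemma s_outside_C: "c \<in> C - B \<Longrightarrow> C.s c \<in> C - B"
  by (rule neg_outside_C) (auto simp: C.s_def C.mn_def)

section \<open>Mixed comparisons under negations and star\<close>

text \<open>By \<open>C.neg_cover\<close> nothing lies strictly between \<open>C.s c\<close> and
  \<open>w\<close>, and neither is in \<open>B\<close>. So both have the same common elements above
  and below, and \<open>cross\<close> cannot tell them apart.\<close>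

lemma cross_neg_right:
  assumes b: "b \<in> B - C" and c: "c \<in> C - B" and w: "w = lC c \<or> w = rC c"
  shows "cross b w \<longleftrightarrow> cross b (C.s c)"
proof
  have sc: "C.s c \<in> C - B" and wC: "w \<in> C - B"
    using s_outside_C[OF c] neg_outside_C[OF c w] by auto
  have le: "leC (C.s c) w" using C.s_le_neg c w by blast
  show "cross b w" if "cross b (C.s c)"
    using cross_mono_right[OF _ _ _ le that] b sc wC by blast
  have n: "leC a (C.s c) \<or> leC w a" if "a \<in> B \<inter> C" for a
    using C.neg_cover[OF _ w, of a] that c sc wC C.total[of a "C.s c"] C.total[of a w] C.refl[of a]
    by auto
  have n': "leC a w \<Longrightarrow> leC a (C.s c)" "leC (C.s c) a \<Longrightarrow> leC w a" if "a \<in> B \<inter> C" for a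
    using n[OF that] that sc wC C.antisym[of a w] C.antisym[of a "C.s c"] by auto
  show "cross b (C.s c)" if "cross b w"
    using that n' unfolding cross_def by blast
qed

lemma cross_neg_left:
  assumes b: "b \<in> B - C" and c: "c \<in> C - B" and w: "w = lB b \<or> w = rB b"
  shows "cross w c \<longleftrightarrow> cross (B.s b) c"
proof
  have sb: "B.s b \<in> B - C" and wB: "w \<in> B - C"
    using s_outside_B[OF b] neg_outside_B[OF b w] by auto
  have le: "leB (B.s b) w" using B.s_le_neg b w by blast
  show "cross (B.s b) c" if "cross w c"
    using cross_antimono_left[OF _ _ le _ that] c sb wB by blast
  have n: "leB a (B.s b) \<or> leB w a" if "a \<in> B \<inter> C" for a
    using B.neg_cover[OF _ w, of a] that b sb wB B.total[of a "B.s b"] B.total[of a w] B.refl[of a]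
    by auto
  have n': "leB a w \<Longrightarrow> leB a (B.s b)" "leB (B.s b) a \<Longrightarrow> leB w a" if "a \<in> B \<inter> C" for a
    using n[OF that] that sb wB B.antisym[of a w] B.antisym[of a "B.s b"] by auto
  \<comment> \<open>The default clause tests the left argument against the unit, so this side needs
    one more fact than \<open>cross_neg_right\<close>.\<close>
  have e': "leB e (B.s b) \<Longrightarrow> leB e w"
    using le B.trans[of e "B.s b" w] e_Int sb wB by auto
  show "cross w c" if "cross (B.s b) c"
    using that n' e' unfolding cross_def by blast
qed

text \<open>The star exchanges separators of the two directions (\<open>1\<close>, \<open>2\<close>)
  and the two sides of the unit (\<open>3\<close>). As separators of both directions cannot coexist
  (\<open>4\<close>), the two default rules become complementary.\<close>

lemma cross_s:
  assumes b: "b \<in> B - C" and c: "c \<in> C - B"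
  shows "cross (B.s b) c \<longleftrightarrow> \<not> cross b (C.s c)"
proof -
  have sb: "B.s b \<in> B - C" and sc: "C.s c \<in> C - B"
    using s_outside_B[OF b] s_outside_C[OF c] by auto
  have sB: "leB (B.s b) (B.s a) \<longleftrightarrow> leB a b" "leB (B.s a) (B.s b) \<longleftrightarrow> leB b a"
    and sC: "leC (C.s c) (C.s a) \<longleftrightarrow> leC a c" "leC (C.s a) (C.s c) \<longleftrightarrow> leC c a"
    and ss: "B.s (C.s a) = a" "C.s (B.s a) = a" "B.s a \<in> B \<inter> C" "C.s a = B.s a"
    if "a \<in> B \<inter> C" for a
    using that b c s_agree[of a] s_Int[of a] B.s_le_iff[of a b] B.s_le_iff[of b a]
      C.s_le_iff[of a c] C.s_le_iff[of c a] B.s_s[of a] C.s_s[of a] by auto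
  have 1: "(\<exists>a\<in>B \<inter> C. leB (B.s b) a \<and> leC a c) \<longleftrightarrow> (\<exists>a\<in>B \<inter> C. leC (C.s c) a \<and> leB a b)"
    using sB sC ss by metis
  have 2: "(\<exists>a\<in>B \<inter> C. leC c a \<and> leB a (B.s b)) \<longleftrightarrow> (\<exists>a\<in>B \<inter> C. leB b a \<and> leC a (C.s c))"
    using sB sC ss by metis
  have 3: "leB e (B.s b) \<longleftrightarrow> \<not> leB e b"
    using B.s_le_iff[of b e] B.s_e B.total[of e b] B.antisym[of e b] b e_Int by auto
  \<comment> \<open>Such separators would squeeze \<open>b\<close> between two common elements that
    coincide, putting \<open>b\<close> into \<open>C\<close>.\<close>
  have 4: "\<not> ((\<exists>a\<in>B \<inter> C. leC (C.s c) a \<and> leB a b) \<and> (\<exists>a\<in>B \<inter> C. leB b a \<and> leC a (C.s c)))"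
  proof clarsimp
    fix a a' assume "a \<in> B" "a \<in> C" "a' \<in> B" "a' \<in> C"
      "leC (C.s c) a" "leB a b" "leB b a'" "leC a' (C.s c)"
    then have "leB a' a" "leB a a'"
      using B.trans[of a b a'] C.trans[of a' "C.s c" a] le_agree[of a' a] b sc by auto
    then show False
      using \<open>a \<in> B\<close> \<open>a \<in> C\<close> \<open>a' \<in> B\<close> \<open>leB a b\<close> \<open>leB b a'\<close> B.antisym b by blast
  qed
  show ?thesis
    unfolding cross_def 1 2 3 using 4 by blast
qed

section \<open>The union as a chain with involutive star\<close>

lemma leD_total: "x \<in> B \<union> C \<Longrightarrow> y \<in> B \<union> C \<Longrightarrow> leD x y \<or> leD y x"
  unfolding leD_def using B.total[of x y] C.total[of x y] by auto

lemma leD_antisym: "\<lbrakk>x \<in> B \<union> C; y \<in> B \<union> C; leD x y; leD y x\<rbrakk> \<Longrightarrow> x = y"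
  unfolding leD_def using B.antisym[of x y] C.antisym[of x y] by (auto split: if_splits)

text \<open>Mixed cases are the monotonicity of \<open>cross\<close> in each argument, or, when the
  middle element comes from the other chain, its contrapositive by totality.\<close>

lemma leD_trans:
  assumes "x \<in> B \<union> C" "y \<in> B \<union> C" "z \<in> B \<union> C" "leD x y" "leD y z"
  shows "leD x z"
proof -
  have B: "leB b b'" if "b \<in> B" "b' \<in> B" "c \<in> C" "cross b c" "\<not> cross b' c" for b b' c
    using that cross_antimono_left B.total by blast
  have C: "leC c' c" if "b \<in> B" "c \<in> C" "c' \<in> C" "cross b c" "\<not> cross b c'" for b c c'
    using that cross_mono_right C.total by blast
  show ?thesis
    using assms B.trans[of x y z] C.trans[of x y z] B[of x z y] C[of y z x]
      cross_mono_right[of x y z] cross_antimono_left[of y x z]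
      cross_mono_right[of z x y] cross_antimono_left[of z y x]
    unfolding leD_def by (auto split: if_splits)
qed

text \<open>For a mixed pair, \<open>cross_neg_right\<close> and \<open>cross_neg_left\<close>
  replace both negations by stars, and \<open>cross_s\<close> exchanges the two sides.\<close>

lemma galoisD:
  assumes x: "x \<in> B \<union> C" and y: "y \<in> B \<union> C"
  shows "leD x (lD y) \<longleftrightarrow> leD y (rD x)"
proof -
  consider "x \<in> B" "y \<in> B" | "x \<in> C" "y \<in> C" | "x \<in> B - C" "y \<in> C - B"
    | "x \<in> C - B" "y \<in> B - C"
    using x y by blast
  then show ?thesis
  proof cases
    case 1
    then show ?thesis by (simp add: leD_B lD_def rD_def B.l_closed B.r_closed B.galois)
  next
    case 2
    then show ?thesis by (simp add: leD_C lD_rD_C C.l_closed C.r_closed C.galois)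
  next
    case 3
    then have "lC y \<in> C - B" "rB x \<in> B - C"
      using neg_outside_B[of x "rB x"] neg_outside_C[of y "lC y"] by auto
    then show ?thesis
      using 3 cross_neg_right[of x y "lC y"] cross_neg_left[of x y "rB x"] cross_s[of x y]
      by (simp add: lD_def rD_def leD_cross)
  next
    case 4
    then have "rC x \<in> C - B" "lB y \<in> B - C"
      using neg_outside_B[of y "lB y"] neg_outside_C[of x "rC x"] by auto
    then show ?thesis
      using 4 cross_neg_right[of y x "rC x"] cross_neg_left[of y x "lB y"] cross_s[of y x]
      by (simp add: lD_def rD_def leD_cross)
  qed
qed

text \<open>For a mixed pair, \<open>cross_s\<close> with the star of the element of
  \<open>C\<close>, whose star is that element again, reverses the comparison; the stars are then
  replaced by the required negations.\<close>

lemma neg_leD_neg: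
  assumes x: "x \<in> B \<union> C" and z: "z \<in> B \<union> C" and xz: "leD x z" "x \<noteq> z"
  shows "leD (lD z) (rD x)" "leD (rD z) (lD x)"
proof -
  consider "x \<in> B" "z \<in> B" | "x \<in> C" "z \<in> C" | "x \<in> B - C" "z \<in> C - B"
    | "x \<in> C - B" "z \<in> B - C"
    using x z by blast
  then have "leD (lD z) (rD x) \<and> leD (rD z) (lD x)"
  proof cases
    case 1
    then show ?thesis
      using xz by (simp add: leD_B lD_def rD_def B.l_closed B.r_closed B.l_le_r B.r_le_l)
  next
    case 2
    then show ?thesis
      using xz by (simp add: leD_C lD_rD_C C.l_closed C.r_closed C.l_le_r C.r_le_l)
  next
    case 3
    then have "\<not> cross (B.s x) (C.s z)"
      using xz cross_s[of x "C.s z"] s_outside_C[of z] by (simp add: leD_cross C.s_s)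
    moreover have "lC z \<in> C - B" "rC z \<in> C - B" "lB x \<in> B - C" "rB x \<in> B - C"
      using 3 neg_outside_B[of x "lB x"] neg_outside_B[of x "rB x"]
        neg_outside_C[of z "lC z"] neg_outside_C[of z "rC z"] by auto
    ultimately show ?thesis
      using 3 cross_neg_right[of _ z] cross_neg_left[of x] s_outside_C[of z]
      by (simp add: lD_def rD_def leD_cross)
  next
    case 4
    then have "cross (B.s z) (C.s x)"
      using xz cross_s[of z "C.s x"] s_outside_C[of x] by (simp add: leD_cross C.s_s)
    moreover have "lC x \<in> C - B" "rC x \<in> C - B" "lB z \<in> B - C" "rB z \<in> B - C"
      using 4 neg_outside_B[of z "lB z"] neg_outside_B[of z "rB z"]
        neg_outside_C[of x "lC x"] neg_outside_C[of x "rC x"] by auto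
    ultimately show ?thesis
      using 4 cross_neg_right[of _ x] cross_neg_left[of z] s_outside_C[of x]
      by (simp add: lD_def rD_def leD_cross)
  qed
  then show "leD (lD z) (rD x)" "leD (rD z) (lD x)" by auto
qed

lemma union_star_chain: "star_chain (B \<union> C) leD e lD rD"
proof -
  have lrD: "lD x \<in> B \<union> C" "rD x \<in> B \<union> C" if "x \<in> B \<union> C" for x
    using that by (auto simp: lD_def rD_def B.l_closed C.l_closed B.r_closed C.r_closed)
  have e: "lD e = e" "rD e = e"
    using B.e_closed by (simp_all add: lD_def rD_def B.l_e B.r_e)
  interpret D: neg_chain "B \<union> C" leD e lD rD
  proof
    show "leD x x" if "x \<in> B \<union> C" for x
      using leD_total[OF that that] by simp
    show "e \<in> B \<union> C"
      using e_Int by simp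
  qed (fact lrD e leD_total leD_antisym leD_trans galoisD neg_leD_neg)+
  \<comment> \<open>On each chain the order and negations of the union are the given ones, so the
    star and its involutivity are inherited.\<close>
  have "D.s x = B.s x" if "x \<in> B" for x
    using that by (simp add: D.s_def B.s_def D.mn_def B.mn_def lD_def rD_def leD_B
        B.l_closed B.r_closed)
  moreover have "D.s x = C.s x" if "x \<in> C" for x
    using that by (simp add: D.s_def C.s_def D.mn_def C.mn_def lD_rD_C leD_C
        C.l_closed C.r_closed)
  ultimately show ?thesis
    by unfold_locales (auto simp: B.s_closed C.s_closed B.s_s C.s_s)
qed

end

section \<open>Overlapping copies in one type and the amalgam\<close>

text \<open>Cardinal arithmetic: an infinite type has room for two disjoint copies of itself, so the
  amalgam can live in the same type.\<close>

lemma infinite_inj_sum: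
  assumes "infinite (UNIV :: 'u set)"
  obtains k :: "'u + 'u \<Rightarrow> 'u" where "inj k"
proof -
  obtain k :: "'u + 'u \<Rightarrow> 'u" where "bij_betw k (UNIV <+> UNIV) UNIV"
    using card_of_Plus_infinite1[OF assms ordLeq_refl[OF card_of_Card_order]] card_of_ordIso by blast
  then show ?thesis
    using that[of k] by (simp add: bij_betw_def)
qed

theorem theorem5p7:
  assumes "infinite (UNIV :: 'u set)"
  shows "strong_amalgamation_property
    {A :: 'u rl_algebra. star_involutive_idempotent_residuated_chain A}"
  unfolding strong_amalgamation_property_def
proof (intro ballI allI impI, elim conjE, simp only: mem_Collect_eq)
  fix A B C :: "'u rl_algebra" and fB fC
  assume A: "star_involutive_idempotent_residuated_chain A"
    and B: "star_involutive_idempotent_residuated_chain B"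
    and C: "star_involutive_idempotent_residuated_chain C"
    and fB: "rl_embedding A B fB" and fC: "rl_embedding A C fC"
  interpret A: star_involutive_idempotent_residuated_chain A by fact
  interpret B: star_involutive_idempotent_residuated_chain B by fact
  interpret C: star_involutive_idempotent_residuated_chain C by fact
  note chains = A.idempotent_residuated_chain_axioms B.idempotent_residuated_chain_axioms
    C.idempotent_residuated_chain_axioms
  note fB' = fB[unfolded rl_embedding_iff[OF chains(1,2)]]
  note fC' = fC[unfolded rl_embedding_iff[OF chains(1,3)]]
  have injA: "inj_on fC (carrier A)" using fC by (simp add: rl_embedding_def)
  obtain k :: "'u + 'u \<Rightarrow> 'u" where k: "inj k" using infinite_inj_sum[OF assms] .
  define gB where "gB = k \<circ> Inl"
  \<comment> \<open>The copies of \<open>B\<close> and \<open>C\<close> go to disjoint halves,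
    except that elements of \<open>C\<close> coming from \<open>A\<close> are sent to the matching
    elements of the copy of \<open>B\<close>.\<close>
  define gC where "gC c = (if c \<in> fC ` carrier A then gB (fB (inv_into (carrier A) fC c))
    else k (Inr c))" for c
  have gB_inj: "inj gB" using k by (auto simp: gB_def inj_def)
  have gCA [simp]: "gC (fC a) = gB (fB a)" if "a \<in> carrier A" for a
    using that injA by (simp add: gC_def)
  \<comment> \<open>The two copies collide only over \<open>A\<close>; this yields both injectivity
    of \<open>gC\<close> and strongness of the amalgam.\<close>
  have gCB: "gC c = gB b \<longleftrightarrow> (\<exists>a\<in>carrier A. c = fC a \<and> b = fB a)" for b c
  proof (cases "c \<in> fC ` carrier A")
    case True
    then obtain a where a: "a \<in> carrier A" "c = fC a" by blast
    then have "gC c = gB b \<longleftrightarrow> fB a = b" using gB_inj by (simp add: inj_eq)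
    then show ?thesis using a injA by (auto dest: inj_onD)
  next
    case False
    then show ?thesis using k by (auto simp: gC_def gB_def inj_eq)
  qed
  have gC_inj: "inj_on gC (carrier C)"
  proof (rule inj_onI)
    fix x y assume xy: "gC x = gC y"
    have injB: "inj_on fB (carrier A)" using fB by (simp add: rl_embedding_def)
    show "x = y"
    \<comment> \<open>If one point comes from \<open>A\<close>, the common value lies in the range
      of \<open>gB\<close>, and \<open>gCB\<close> identifies both points over
      \<open>A\<close>.\<close>
    proof (cases "x \<in> fC ` carrier A \<or> y \<in> fC ` carrier A")
      case True
      then obtain a where a: "a \<in> carrier A" "x = fC a \<or> y = fC a" by blast
      then have "gC x = gB (fB a)" "gC y = gB (fB a)" using xy by auto
      then show ?thesis
        using injB a(1) unfolding gCB by (auto dest: inj_onD)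
    next
      case False
      then show ?thesis using xy k by (simp add: gC_def inj_eq)
    qed
  qed
  define hB where "hB = inv_into (carrier B) gB"
  define hC where "hC = inv_into (carrier C) gC"
  have hB [simp]: "hB (gB b) = b" if "b \<in> carrier B" for b
    using that gB_inj by (simp add: hB_def inj_on_subset)
  have hC [simp]: "hC (gC c) = c" if "c \<in> carrier C" for c
    using that gC_inj by (simp add: hC_def)
  have mem: "fB a \<in> carrier B" "fC a \<in> carrier C" if "a \<in> carrier A" for a
    using that fB' fC' by auto
  have e: "gC \<one>\<^bsub>C\<^esub> = gB \<one>\<^bsub>B\<^esub>"
    using gCA[of "\<one>\<^bsub>A\<^esub>"] fB' fC' by simp
  let ?leB = "\<lambda>u v. hB u \<preceq>\<^bsub>B\<^esub> hB v" and ?leC = "\<lambda>u v. hC u \<preceq>\<^bsub>C\<^esub> hC v"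
  let ?lB = "gB \<circ> lneg B \<circ> hB" and ?rB = "gB \<circ> rneg B \<circ> hB"
  let ?lC = "gC \<circ> lneg C \<circ> hC" and ?rC = "gC \<circ> rneg C \<circ> hC"
  have sB: "star_chain (gB ` carrier B) ?leB (gB \<one>\<^bsub>B\<^esub>) ?lB ?rB"
    unfolding hB_def by (rule star_chain_image[OF B.star_chain inj_on_subset[OF gB_inj subset_UNIV]])
  have sC: "star_chain (gC ` carrier C) ?leC (gB \<one>\<^bsub>B\<^esub>) ?lC ?rC"
    unfolding hC_def e[symmetric] by (rule star_chain_image[OF C.star_chain gC_inj])
  have Int: "gB ` carrier B \<inter> gC ` carrier C = gB ` fB ` carrier A"
  proof (intro equalityI subsetI)
    fix u assume "u \<in> gB ` carrier B \<inter> gC ` carrier C"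
    then obtain b c where "u = gB b" "u = gC c" by blast
    then show "u \<in> gB ` fB ` carrier A" using gCB by auto
  next
    fix u assume "u \<in> gB ` fB ` carrier A"
    then obtain a where a: "a \<in> carrier A" "u = gB (fB a)" by auto
    then have "u = gC (fC a)" by simp
    then show "u \<in> gB ` carrier B \<inter> gC ` carrier C" using a mem by blast
  qed
  have hA [simp]: "hB (gB (fB a)) = fB a" "hC (gB (fB a)) = fC a" if "a \<in> carrier A" for a
  proof -
    show "hB (gB (fB a)) = fB a" using mem[OF that] by simp
    show "hC (gB (fB a)) = fC a" using mem[OF that] hC[of "fC a"] that by simp
  qed
  have neg: "gB (lneg B (fB a)) = gC (lneg C (fC a))" "gB (rneg B (fB a)) = gC (rneg C (fC a))"
    if "a \<in> carrier A" for a
  proof -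
    have "lneg B (fB a) = fB (lneg A a)" "lneg C (fC a) = fC (lneg A a)"
      "rneg B (fB a) = fB (rneg A a)" "rneg C (fC a) = fC (rneg A a)"
      using that fB' fC' by metis+
    then show "gB (lneg B (fB a)) = gC (lneg C (fC a))" "gB (rneg B (fB a)) = gC (rneg C (fC a))"
      using gCA[of "lneg A a"] gCA[of "rneg A a"] that A.lneg_closed A.rneg_closed by simp_all
  qed
  have le: "fB a \<preceq>\<^bsub>B\<^esub> fB a' \<longleftrightarrow> fC a \<preceq>\<^bsub>C\<^esub> fC a'" if "a \<in> carrier A" "a' \<in> carrier A" for a a'
    using that fB' fC' by metis
  \<comment> \<open>By \<open>Int\<close> agreement is checked only at points
    \<open>gB (fB a)\<close>, where it holds because \<open>fB\<close> and \<open>fC\<close> carry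
    the same order and negations of \<open>A\<close>.\<close>
  interpret am: star_chain_amalgam "gB ` carrier B" ?leB "gB \<one>\<^bsub>B\<^esub>" ?lB ?rB
    "gC ` carrier C" ?leC ?lC ?rC
    by (intro star_chain_amalgam.intro star_chain_amalgam_axioms.intro sB sC; unfold Int)
      (auto simp: le neg)
  interpret D: star_chain "gB ` carrier B \<union> gC ` carrier C" am.leD "gB \<one>\<^bsub>B\<^esub>" am.lD am.rD
    by (rule am.union_star_chain)
  have D: "star_involutive_idempotent_residuated_chain D.alg" by (rule D.alg_star_chain)
  \<comment> \<open>By \<open>rl_embedding_iff\<close> only order, unit and negations matter, and on
    each copy those of the union are the transported ones.\<close>
  have eB: "rl_embedding B D.alg gB"
    unfolding rl_embedding_iff[OF chains(2) D.alg_chain]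
    by (auto simp: D.rle_alg D.neg_alg am.leD_B am.lD_def am.rD_def)
  have eC: "rl_embedding C D.alg gC"
    unfolding rl_embedding_iff[OF chains(3) D.alg_chain]
    by (auto simp: D.rle_alg D.neg_alg am.leD_C am.lD_rD_C e)
  have "(gB \<circ> fB) ` carrier A = gB ` carrier B \<inter> gC ` carrier C"
    unfolding Int by (rule image_comp[symmetric])
  moreover have "\<forall>x\<in>carrier A. (gB \<circ> fB) x = (gC \<circ> fC) x" by simp
  ultimately show "\<exists>D\<in>{A :: 'u rl_algebra. star_involutive_idempotent_residuated_chain A}. \<exists>gB gC.
      rl_embedding B D gB \<and> rl_embedding C D gC \<and>
      (\<forall>x\<in>carrier A. (gB \<circ> fB) x = (gC \<circ> fC) x) \<and>
      (gB \<circ> fB) ` carrier A = gB ` carrier B \<inter> gC ` carrier C"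
    using D eB eC by blast
qed

end
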